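(* Let $W$ be a finite Coxeter group presented with generators $s_1,\dots,s_n$ ($n\geq 1$), and let $H_0(W)$ be its associated $0$-Hecke monoid. Then $H_0(W)$ is not Ramsey, except in the degenerate case that $W$ has only one generator (i.e. if $n\geq 2$, then $H_0(W)$ is not Ramsey).
   Context: A Coxeter group is a group $W$ given by a presentation $W=\langle s_1,\dots,s_n \mid (s_is_j)^{m_{ij}}=1\rangle$ with $m_{ii}=1$ and $2\leq m_{ij}=m_{ji}\leq\infty$ for $i\neq j$. Equivalently, the relations are $s_i^2=1$ together with the braid relations $s_is_js_i\cdots = s_js_is_j\cdots$ for $i\ne j$ (alternating products with $m_{ij}$ factors on each side). For finite $W$, the $0$-Hecke monoid $H_0(W)$ is the monoid generated by $\pi_1,\dots,\pi_n$ subject to $\pi_i^2=\pi_i$ and the same braid relations $\pi_i\pi_j\pi_i\cdots=\pi_j\pi_i\pi_j\cdots$ ($m_{ij}$ factors on each side). Ramsey monoids: let $M$ be a finite monoid. A pointed $M$-set is a set $X$ with an action of $M$ and a distinguished point $x\in X$ such that $Mx=X$. Given a sequence $(X_n)_{n\in\mathbb{N}}$ of pointed $M$-sets, treated as mutually disjoint, let $\langle (X_n)\rangle$ be the set of all finite partial functions $f:\mathbb{N}\to\bigcup_n X_n$ with $f(n)\in X_n$ for all $n\in\operatorname{dom}(f)$. For $f,g\in\langle (X_n)\rangle$ write $f\prec g$ if $\max(\operatorname{dom}(f))<\min(\operatorname{dom}(g))$; in that case the product $fg$ is defined to be $f\cup g\in\langle (X_n)\rangle$. $M$ acts on $\langle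 (X_n)\rangle$ coordinatewise: $m(f)$ has the same domain as $f$ and $m(f)(n)=m\cdot f(n)$. The sequence $(X_n)$ has the Ramsey property if for every finite colouring of $\langle (X_n)\rangle$ there is a sequence $B=\{f_i\}_{i\in\mathbb{N}}\subseteq\langle (X_n)\rangle$ such that: (1) $f_i\prec f_{i+1}$ for all $i$; (2) for each $i$, the range of $f_i$ includes the distinguished element of $X_n$ for some $n\in\operatorname{dom}(f_i)$; (3) the set $[B]=\{m_0(f_{i_0})\cdots m_k(f_{i_k}) : k\in\mathbb{N},\ i_0<\dots<i_k,\ m_j\in M \text{ for all } j,\ m_j=1_M\text{ for at least one } j\}$ is monochromatic. $M$ is Ramsey if every sequence of pointed $M$-sets has the Ramsey property. *)

theory Defs
  imports "HOL-Algebra.Group" "HOL-Library.Extended_Nat"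
begin

section \<open>Monoids and groups given by presentations\<close>

inductive_set pres_cong :: "'a set \<Rightarrow> ('a list \<times> 'a list) set \<Rightarrow> ('a list \<times> 'a list) set"
  for S R where
  pc_rel: "(u, v) \<in> R \<Longrightarrow> u \<in> lists S \<Longrightarrow> v \<in> lists S \<Longrightarrow> (u, v) \<in> pres_cong S R"
| pc_refl: "u \<in> lists S \<Longrightarrow> (u, u) \<in> pres_cong S R"
| pc_sym: "(u, v) \<in> pres_cong S R \<Longrightarrow> (v, u) \<in> pres_cong S R"
| pc_trans: "(u, v) \<in> pres_cong S R \<Longrightarrow> (v, w) \<in> pres_cong S R \<Longrightarrow> (u, w) \<in> pres_cong S R"
| pc_app: "(u, v) \<in> pres_cong S R \<Longrightarrow> (u', v') \<in> pres_cong S R \<Longrightarrow>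
    (u @ u', v @ v') \<in> pres_cong S R"

definition presented_monoid ::
  "'a set \<Rightarrow> ('a list \<times> 'a list) set \<Rightarrow> 'a list set monoid" where
  "presented_monoid S R =
    \<lparr> carrier = lists S // pres_cong S R,
      mult = (\<lambda>A B. \<Union>u\<in>A. \<Union>v\<in>B. pres_cong S R `` {u @ v}),
      one = pres_cong S R `` {[]} \<rparr>"

text \<open>The letter \<open>(a, True)\<close> stands for the generator \<open>a\<close>, and \<open>(a, False)\<close> for its inverse.
  The relators \<open>R\<close> are words in these letters.\<close>

definition presented_group ::
  "'a set \<Rightarrow> ('a \<times> bool) list set \<Rightarrow> ('a \<times> bool) list set monoid" where
  "presented_group S R =
    presented_monoid (S \<times> UNIV)
      ({([(a, b), (a, \<not> b)], []) | a b. a \<in> S} \<union> {(r, []) | r. r \<in> R})"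

lemma pres_cong_lists:
  "(u, v) \<in> pres_cong S R \<Longrightarrow> u \<in> lists S \<and> v \<in> lists S"
  by (induction rule: pres_cong.induct) auto

lemma equiv_pres_cong: "equiv (lists S) (pres_cong S R)"
proof (rule equivI)
  show "pres_cong S R \<subseteq> lists S \<times> lists S" using pres_cong_lists by fast
  show "refl_on (lists S) (pres_cong S R)"
    by (rule refl_onI) (rule pc_refl)
  show "sym (pres_cong S R)" by (rule symI) (rule pc_sym)
  show "trans (pres_cong S R)" by (rule transI) (rule pc_trans)
qed

lemma presented_monoid_mult:
  assumes "u \<in> lists S" "v \<in> lists S"
  shows "pres_cong S R `` {u} \<otimes>\<^bsub>presented_monoid S R\<^esub> pres_cong S R `` {v}
    = pres_cong S R `` {u @ v}"
proof -
  let ?C = "pres_cong S R"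
  have eq: "?C `` {u' @ v'} = ?C `` {u @ v}" if "u' \<in> ?C `` {u}" "v' \<in> ?C `` {v}" for u' v'
  proof -
    have "(u @ v, u' @ v') \<in> ?C" using that by (intro pc_app) auto
    then show ?thesis using equiv_class_eq[OF equiv_pres_cong] by metis
  qed
  have "(\<Union>u'\<in>?C `` {u}. \<Union>v'\<in>?C `` {v}. ?C `` {u' @ v'})
      = (\<Union>u'\<in>?C `` {u}. \<Union>v'\<in>?C `` {v}. ?C `` {u @ v})"
    by (intro SUP_cong refl eq)
  moreover have "u \<in> ?C `` {u}" "v \<in> ?C `` {v}"
    using assms by (auto intro: pc_refl)
  then have "(\<Union>u'\<in>?C `` {u}. \<Union>v'\<in>?C `` {v}. ?C `` {u @ v}) = ?C `` {u @ v}"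
    by blast
  ultimately show ?thesis by (simp only: presented_monoid_def monoid.simps)
qed

lemma presented_monoid_carrier:
  "carrier (presented_monoid S R) = (\<lambda>u. pres_cong S R `` {u}) ` lists S"
  by (auto simp: presented_monoid_def quotient_def)

lemma monoid_presented_monoid: "monoid (presented_monoid S R)"
proof -
  have one: "\<one>\<^bsub>presented_monoid S R\<^esub> = pres_cong S R `` {[]}"
    by (simp add: presented_monoid_def)
  show ?thesis
  proof (rule monoidI)
    fix x y z
    assume "x \<in> carrier (presented_monoid S R)" "y \<in> carrier (presented_monoid S R)"
      "z \<in> carrier (presented_monoid S R)"
    then obtain u v w where *: "u \<in> lists S" "v \<in> lists S" "w \<in> lists S"
      "x = pres_cong S R `` {u}" "y = pres_cong S R `` {v}" "z = pres_cong S R `` {w}"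
      unfolding presented_monoid_carrier by auto
    then have "u @ v \<in> lists S" "v @ w \<in> lists S" by auto
    then show "x \<otimes>\<^bsub>presented_monoid S R\<^esub> y \<otimes>\<^bsub>presented_monoid S R\<^esub> z
        = x \<otimes>\<^bsub>presented_monoid S R\<^esub> (y \<otimes>\<^bsub>presented_monoid S R\<^esub> z)"
      using * by (simp only: presented_monoid_mult append_assoc)
  next
    fix x y
    assume "x \<in> carrier (presented_monoid S R)" "y \<in> carrier (presented_monoid S R)"
    then obtain u v where *: "u \<in> lists S" "v \<in> lists S"
      "x = pres_cong S R `` {u}" "y = pres_cong S R `` {v}"
      unfolding presented_monoid_carrier by auto
    then have "u @ v \<in> lists S" by auto
    then show "x \<otimes>\<^bsub>presented_monoid S R\<^esub> y \<in> carrier (presented_monoid S R)"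
      using * unfolding presented_monoid_carrier by (simp only: presented_monoid_mult) blast
  next
    show "\<one>\<^bsub>presented_monoid S R\<^esub> \<in> carrier (presented_monoid S R)"
      unfolding presented_monoid_carrier one by blast
  next
    fix x assume "x \<in> carrier (presented_monoid S R)"
    then obtain u where *: "u \<in> lists S" "x = pres_cong S R `` {u}"
      unfolding presented_monoid_carrier by auto
    have nil: "[] \<in> lists S" by simp
    show "\<one>\<^bsub>presented_monoid S R\<^esub> \<otimes>\<^bsub>presented_monoid S R\<^esub> x = x"
      unfolding one *(2) using presented_monoid_mult[OF nil *(1)] by simp
    show "x \<otimes>\<^bsub>presented_monoid S R\<^esub> \<one>\<^bsub>presented_monoid S R\<^esub> = x"
      unfolding one *(2) using presented_monoid_mult[OF *(1) nil] by simp
  qed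
qed

lemma group_presented_group:
  fixes S :: "'a set"
  shows "group (presented_group S R)"
proof -
  define T where "T = S \<times> (UNIV :: bool set)"
  define Q :: "(('a \<times> bool) list \<times> ('a \<times> bool) list) set"
    where "Q = {([(a, b), (a, \<not> b)], []) | a b. a \<in> S} \<union> {(r, []) | r. r \<in> R}"
  have G: "presented_group S R = presented_monoid T Q"
    by (simp add: presented_group_def T_def Q_def)
  interpret monoid "presented_monoid T Q" by (rule monoid_presented_monoid)
  have inverse: "\<exists>v \<in> lists T. (v @ u, []) \<in> pres_cong T Q" if "u \<in> lists T" for u
    using that
  proof (induction u)
    case Nil
    then show ?case by (auto intro: pc_refl)
  next
    case (Cons x u)
    then obtain v where v: "v \<in> lists T" "(v @ u, []) \<in> pres_cong T Q" by blast
    obtain a b where x: "x = (a, b)" by fastforce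
    with Cons have a: "a \<in> S" by (simp add: T_def)
    have "([(a, \<not> b), (a, \<not> \<not> b)], []) \<in> Q"
      using a unfolding Q_def by blast
    then have "([(a, \<not> b), (a, b)], []) \<in> pres_cong T Q"
      using a by (intro pc_rel) (auto simp: T_def)
    then have "([(a, \<not> b), (a, b)] @ u, [] @ u) \<in> pres_cong T Q"
      using Cons by (intro pc_app) (auto intro: pc_refl)
    then have "(v @ [(a, \<not> b), (a, b)] @ u, v @ [] @ u) \<in> pres_cong T Q"
      by (rule pc_app[OF pc_refl[OF v(1)]])
    then have "((v @ [(a, \<not> b)]) @ x # u, []) \<in> pres_cong T Q"
      using v x by (auto intro: pc_trans)
    moreover have "v @ [(a, \<not> b)] \<in> lists T" using v a by (auto simp: T_def)
    ultimately show ?case by blast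
  qed
  show ?thesis
    unfolding G
  proof (rule groupI)
    fix x assume "x \<in> carrier (presented_monoid T Q)"
    then obtain u where u: "u \<in> lists T" "x = pres_cong T Q `` {u}"
      unfolding presented_monoid_carrier by auto
    obtain v where v: "v \<in> lists T" "(v @ u, []) \<in> pres_cong T Q"
      using inverse[OF u(1)] by blast
    have "pres_cong T Q `` {v} \<otimes>\<^bsub>presented_monoid T Q\<^esub> x = \<one>\<^bsub>presented_monoid T Q\<^esub>"
      unfolding u(2) presented_monoid_mult[OF v(1) u(1)]
        equiv_class_eq[OF equiv_pres_cong v(2)]
      by (simp add: presented_monoid_def)
    then show "\<exists>y\<in>carrier (presented_monoid T Q).
        y \<otimes>\<^bsub>presented_monoid T Q\<^esub> x = \<one>\<^bsub>presented_monoid T Q\<^esub>"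
      using v(1) unfolding presented_monoid_carrier by blast
  qed (auto simp: m_assoc)
qed

section \<open>Coxeter groups and 0-Hecke monoids\<close>

definition coxeter_matrix :: "nat \<Rightarrow> (nat \<Rightarrow> nat \<Rightarrow> enat) \<Rightarrow> bool" where
  "coxeter_matrix n m \<longleftrightarrow>
    (\<forall>i\<in>{1..n}. m i i = 1) \<and>
    (\<forall>i\<in>{1..n}. \<forall>j\<in>{1..n}. i \<noteq> j \<longrightarrow> 2 \<le> m i j \<and> m i j = m j i)"

text \<open>An entry \<open>m i j = \<infinity>\<close> contributes no relation.\<close>

definition coxeter_group ::
  "nat \<Rightarrow> (nat \<Rightarrow> nat \<Rightarrow> enat) \<Rightarrow> (nat \<times> bool) list set monoid" where
  "coxeter_group n m =
    presented_group {1..n}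
      {concat (replicate k [(i, True), (j, True)]) | i j k.
        i \<in> {1..n} \<and> j \<in> {1..n} \<and> m i j = enat k}"

fun alternating :: "nat \<Rightarrow> 'a \<Rightarrow> 'a \<Rightarrow> 'a list" where
  "alternating 0 a b = []"
| "alternating (Suc k) a b = a # alternating k b a"

definition hecke0_monoid ::
  "nat \<Rightarrow> (nat \<Rightarrow> nat \<Rightarrow> enat) \<Rightarrow> nat list set monoid" where
  "hecke0_monoid n m =
    presented_monoid {1..n}
      ({([i, i], [i]) | i. i \<in> {1..n}} \<union>
       {(alternating k i j, alternating k j i) | i j k.
         i \<in> {1..n} \<and> j \<in> {1..n} \<and> i \<noteq> j \<and> m i j = enat k})"

section \<open>Ramsey monoids\<close>

definition pointed_mset ::
  "('m, 'c) monoid_scheme \<Rightarrow> 'x set \<Rightarrow> ('m \<Rightarrow> 'x \<Rightarrow> 'x) \<Rightarrow> 'x \<Rightarrow> bool" where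
  "pointed_mset M X act x \<longleftrightarrow>
    (\<forall>m\<in>carrier M. \<forall>y\<in>X. act m y \<in> X) \<and>
    (\<forall>y\<in>X. act \<one>\<^bsub>M\<^esub> y = y) \<and>
    (\<forall>m\<in>carrier M. \<forall>m'\<in>carrier M. \<forall>y\<in>X. act (m \<otimes>\<^bsub>M\<^esub> m') y = act m (act m' y)) \<and>
    x \<in> X \<and>
    (\<lambda>m. act m x) ` carrier M = X"

text \<open>The sets \<open>X n\<close> need not be disjoint as sets: a value \<open>f n\<close> is always
  regarded as an element of the \<open>n\<close>-th set, which has the same effect as disjointness.\<close>

definition fin_pfuns :: "(nat \<Rightarrow> 'x set) \<Rightarrow> (nat \<rightharpoonup> 'x) set" where
  "fin_pfuns X = {f. finite (dom f) \<and> (\<forall>n\<in>dom f. the (f n) \<in> X n)}"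

definition pf_prec :: "(nat \<rightharpoonup> 'x) \<Rightarrow> (nat \<rightharpoonup> 'x) \<Rightarrow> bool" where
  "pf_prec f g \<longleftrightarrow> dom f \<noteq> {} \<and> dom g \<noteq> {} \<and> Max (dom f) < Min (dom g)"

definition pf_act :: "(nat \<Rightarrow> 'm \<Rightarrow> 'x \<Rightarrow> 'x) \<Rightarrow> 'm \<Rightarrow> (nat \<rightharpoonup> 'x) \<Rightarrow> (nat \<rightharpoonup> 'x)" where
  "pf_act act m f = (\<lambda>n. map_option (act n m) (f n))"

text \<open>The products below are of partial functions with increasing disjoint domains,
  so \<open>++\<close> is their union.\<close>

definition pf_span ::
  "('m, 'c) monoid_scheme \<Rightarrow> (nat \<Rightarrow> 'm \<Rightarrow> 'x \<Rightarrow> 'x) \<Rightarrow> (nat \<Rightarrow> nat \<rightharpoonup> 'x) \<Rightarrow> (nat \<rightharpoonup> 'x) set"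
  where
  "pf_span M act F =
    {foldr (\<lambda>j g. pf_act act (ms j) (F (is j)) ++ g) [0..<Suc k] Map.empty | k is ms.
      strict_mono_on {..k} is \<and> (\<forall>j\<le>k. ms j \<in> carrier M) \<and> (\<exists>j\<le>k. ms j = \<one>\<^bsub>M\<^esub>)}"

definition ramsey_property ::
  "('m, 'c) monoid_scheme \<Rightarrow> (nat \<Rightarrow> 'x set) \<Rightarrow> (nat \<Rightarrow> 'm \<Rightarrow> 'x \<Rightarrow> 'x) \<Rightarrow> (nat \<Rightarrow> 'x) \<Rightarrow> bool"
  where
  "ramsey_property M X act pt \<longleftrightarrow>
    (\<forall>col :: (nat \<rightharpoonup> 'x) \<Rightarrow> nat. finite (col ` fin_pfuns X) \<longrightarrow>
      (\<exists>F :: nat \<Rightarrow> nat \<rightharpoonup> 'x.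
        (\<forall>i. F i \<in> fin_pfuns X) \<and>
        (\<forall>i. pf_prec (F i) (F (Suc i))) \<and>
        (\<forall>i. \<exists>n\<in>dom (F i). F i n = Some (pt n)) \<and>
        (\<exists>c. \<forall>g\<in>pf_span M act F. col g = c)))"

text \<open>HOL cannot quantify over all types of underlying sets here. As every pointed \<open>M\<close>-set is
  the image of \<open>M\<close> under \<open>m \<mapsto> m x\<close>, it is isomorphic to one whose underlying set is a subset
  of \<open>M\<close>, so it suffices to take underlying sets in the type of \<open>M\<close>; this is justified by
  lemma \<open>ramsey_monoid_any_type\<close> below.\<close>

definition ramsey_monoid :: "('m, 'c) monoid_scheme \<Rightarrow> bool" where
  "ramsey_monoid M \<longleftrightarrow>
    (\<forall>(X :: nat \<Rightarrow> 'm set) act pt.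
      (\<forall>n. pointed_mset M (X n) (act n) (pt n)) \<longrightarrow> ramsey_property M X act pt)"

lemma ramsey_monoid_any_type:
  fixes M :: "('m, 'c) monoid_scheme" and X :: "nat \<Rightarrow> 'x set"
  assumes M: "monoid M" and ramsey: "ramsey_monoid M"
    and X: "\<And>n. pointed_mset M (X n) (act n) (pt n)"
  shows "ramsey_property M X act pt"
  unfolding ramsey_property_def
proof (intro allI impI)
  fix col :: "(nat \<rightharpoonup> 'x) \<Rightarrow> nat"
  assume col: "finite (col ` fin_pfuns X)"
  interpret monoid M by (rule M)
  define h where "h n = inv_into (carrier M) (\<lambda>m. act n m (pt n))" for n
  define k where "k n = (\<lambda>m. act n m (pt n))" for n
  have kh: "k n (h n y) = y" if "y \<in> X n" for n y
    using X[of n] that unfolding h_def k_def pointed_mset_def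
    by (metis (no_types, lifting) f_inv_into_f)
  define X' where "X' n = h n ` X n" for n
  define act' where "act' n m z = h n (act n m (k n z))" for n m z
  define pt' where "pt' n = h n (pt n)" for n
  have kX: "k n z \<in> X n" if "z \<in> X' n" for n z
    using that kh unfolding X'_def by auto
  have clos: "act n m y \<in> X n" if "m \<in> carrier M" "y \<in> X n" for n m y
    using X[of n] that unfolding pointed_mset_def by blast
  have ptX: "pt n \<in> X n" for n
    using X[of n] unfolding pointed_mset_def by blast
  have "pointed_mset M (X' n) (act' n) (pt' n)" for n
    unfolding pointed_mset_def
  proof (intro conjI ballI)
    show "act' n m z \<in> X' n" if "m \<in> carrier M" "z \<in> X' n" for m z
      using clos[OF that(1) kX[OF that(2)]] unfolding act'_def X'_def by blast
    show "act' n \<one>\<^bsub>M\<^esub> z = z" if "z \<in> X' n" for z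
      using that X[of n] kh unfolding act'_def X'_def pointed_mset_def by auto
    show "act' n (m \<otimes>\<^bsub>M\<^esub> m') z = act' n m (act' n m' z)"
      if "m \<in> carrier M" "m' \<in> carrier M" "z \<in> X' n" for m m' z
      using that X[of n] kh[OF clos[OF that(2) kX[OF that(3)]]] kX[OF that(3)]
      unfolding act'_def pointed_mset_def by auto
    show "pt' n \<in> X' n" using ptX unfolding pt'_def X'_def by blast
    have "(\<lambda>m. act n m (pt n)) ` carrier M = X n"
      using X[of n] unfolding pointed_mset_def by blast
    then show "(\<lambda>m. act' n m (pt' n)) ` carrier M = X' n"
      unfolding act'_def pt'_def X'_def kh[OF ptX] by (metis image_image)
  qed
  then have rp: "ramsey_property M X' act' pt'"
    using ramsey unfolding ramsey_monoid_def by blast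
  define t where "t g = (\<lambda>n. map_option (k n) (g n))" for g
  have dom_t: "dom (t g) = dom g" for g by (auto simp: t_def)
  have t_in: "t g \<in> fin_pfuns X" if "g \<in> fin_pfuns X'" for g
    using that kX dom_t[of g] unfolding fin_pfuns_def by (force simp: t_def)
  have "(\<lambda>g. col (t g)) ` fin_pfuns X' \<subseteq> col ` fin_pfuns X" using t_in by blast
  then have "finite ((\<lambda>g. col (t g)) ` fin_pfuns X')" using col finite_subset by blast
  then obtain F c where F: "\<And>i. F i \<in> fin_pfuns X'" "\<And>i. pf_prec (F i) (F (Suc i))"
      "\<And>i. \<exists>n\<in>dom (F i). F i n = Some (pt' n)"
      "\<And>g. g \<in> pf_span M act' F \<Longrightarrow> col (t g) = c"
    using rp[unfolded ramsey_property_def, rule_format, of "\<lambda>g. col (t g)"] by blast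
  have t_act: "t (pf_act act' m f) = pf_act act m (t f)"
    if m: "m \<in> carrier M" and f: "f \<in> fin_pfuns X'" for m f
  proof
    fix n
    show "t (pf_act act' m f) n = pf_act act m (t f) n"
    proof (cases "f n")
      case None
      then show ?thesis by (simp add: t_def pf_act_def)
    next
      case (Some z)
      then have "z \<in> X' n" using f unfolding fin_pfuns_def by force
      then show ?thesis
        using Some kh[OF clos[OF m kX]] by (simp add: t_def pf_act_def act'_def)
    qed
  qed
  have t_add: "t (f ++ g) = t f ++ t g" for f g
    by (rule ext) (simp add: t_def map_add_def split: option.split)
  have t_foldr: "t (foldr (\<lambda>j g. pf_act act' (ms j) (F (is j)) ++ g) js Map.empty)
      = foldr (\<lambda>j g. pf_act act (ms j) (t (F (is j))) ++ g) js Map.empty"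
    if "\<forall>j\<in>set js. ms j \<in> carrier M" for ms "is" and js :: "nat list"
    using that
  proof (induction js)
    case Nil
    then show ?case by (simp add: t_def)
  next
    case (Cons j js)
    then show ?case using t_act F(1) by (simp add: t_add)
  qed
  have "col g = c" if "g \<in> pf_span M act (\<lambda>i. t (F i))" for g
  proof -
    obtain q "is" ms where *: "strict_mono_on {..q} is" "\<forall>j\<le>q. ms j \<in> carrier M"
        "\<exists>j\<le>q. ms j = \<one>\<^bsub>M\<^esub>"
        "g = foldr (\<lambda>j g. pf_act act (ms j) (t (F (is j))) ++ g) [0..<Suc q] Map.empty"
      using \<open>g \<in> _\<close> unfolding pf_span_def by blast
    define g' where
      "g' = foldr (\<lambda>j g. pf_act act' (ms j) (F (is j)) ++ g) [0..<Suc q] Map.empty"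
    have "g' \<in> pf_span M act' F"
      unfolding pf_span_def g'_def using *(1-3) by blast
    moreover have "\<forall>j\<in>set [0..<Suc q]. ms j \<in> carrier M" using *(2) by auto
    then have "t g' = g" unfolding g'_def *(4) by (rule t_foldr)
    ultimately show ?thesis using F(4) by blast
  qed
  moreover have "\<exists>n\<in>dom (t (F i)). t (F i) n = Some (pt n)" for i
    using F(3)[of i] kh[OF ptX] unfolding dom_t by (force simp: t_def pt'_def)
  moreover have "pf_prec (t (F i)) (t (F (Suc i)))" for i
    using F(2)[of i] unfolding pf_prec_def dom_t .
  ultimately show "\<exists>F. (\<forall>i. F i \<in> fin_pfuns X) \<and> (\<forall>i. pf_prec (F i) (F (Suc i))) \<and>
      (\<forall>i. \<exists>n\<in>dom (F i). F i n = Some (pt n)) \<and> (\<exists>c. \<forall>g\<in>pf_span M act F. col g = c)"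
    using t_in[OF F(1)] by (intro exI[of _ "\<lambda>i. t (F i)"] conjI allI exI[of _ c] ballI) simp_all
qed

end

theory Submission imports Defs begin

text \<open>If \<open>a \<notin> bM\<close> and \<open>b \<notin> aM\<close>, then \<open>M\<close> is not Ramsey: let \<open>M\<close> act on itself and colour a
  partial function by whether a value outside \<open>bM\<close> occurs before all values outside \<open>aM\<close>.
  This holds for \<open>a(f\<^sub>0)f\<^sub>1\<close>, where the distinguished point of \<open>f\<^sub>0\<close> becomes \<open>a\<close>, and fails for
  \<open>b(f\<^sub>0)f\<^sub>1\<close>. In a 0-Hecke monoid the set of generators occurring in a word depends only
  on the element it represents, so any two distinct generators are such \<open>a\<close> and \<open>b\<close>.\<close>

text \<open>The required multiplier \<open>1\<close> can be spent on \<open>F 1\<close>, which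
  leaves the multiplier of \<open>F 0\<close> free. Comparing two choices of \<open>c\<close> on the
  same \<open>F\<close> is what defeats a colouring.\<close>

lemma pf_span_act_first:
  assumes "monoid M" "c \<in> carrier M"
  shows "pf_act act c (F 0) ++ pf_act act \<one>\<^bsub>M\<^esub> (F 1) \<in> pf_span M act F"
proof -
  interpret monoid M by fact
  let ?ms = "\<lambda>j :: nat. if j = 0 then c else \<one>\<^bsub>M\<^esub>"
  have "pf_act act c (F 0) ++ pf_act act \<one>\<^bsub>M\<^esub> (F 1)
      = foldr (\<lambda>j g. pf_act act (?ms j) (F (id j)) ++ g) [0..<Suc 1] Map.empty"
    by simp
  moreover have "strict_mono_on {..1} (id :: nat \<Rightarrow> nat)"
    by (simp add: strict_mono_on_def)
  moreover have "\<forall>j\<le>1. ?ms j \<in> carrier M" using assms by simp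
  moreover have "\<exists>j\<le>1. ?ms j = \<one>\<^bsub>M\<^esub>" by (intro exI[of _ 1]) simp
  ultimately show ?thesis
    unfolding pf_span_def
    by - (rule CollectI, rule exI[of _ 1], rule exI[of _ id], rule exI[of _ ?ms], intro conjI)
qed

lemma pf_prec_less:
  assumes "pf_prec f g" "finite (dom f)" "finite (dom g)" "p \<in> dom f" "q \<in> dom g"
  shows "p < q"
proof -
  have "p \<le> Max (dom f)" "Min (dom g) \<le> q" using assms by simp_all
  then show ?thesis using assms(1) unfolding pf_prec_def by linarith
qed

lemma pointed_mset_regular:
  assumes "monoid M"
  shows "pointed_mset M (carrier M) (mult M) \<one>\<^bsub>M\<^esub>"
proof -
  interpret monoid M by fact
  show ?thesis
    unfolding pointed_mset_def by (auto simp: m_assoc image_iff)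
qed

lemma not_ramsey_monoid_if_incomparable:
  fixes M :: "('m, 'c) monoid_scheme"
  assumes M: "monoid M" and a: "a \<in> carrier M" and b: "b \<in> carrier M"
    and ab: "a \<notin> mult M b ` carrier M" and ba: "b \<notin> mult M a ` carrier M"
  shows "\<not> ramsey_monoid M"
proof
  assume "ramsey_monoid M"
  interpret monoid M by (rule M)
  define out where "out c f = {p. \<exists>y. f p = Some y \<and> y \<notin> mult M c ` carrier M}"
    for c and f :: "nat \<rightharpoonup> 'm"
  \<comment> \<open>When \<open>out a f\<close> is empty, this only asks that \<open>out b f\<close>
    be nonempty.\<close>
  define early where "early f \<longleftrightarrow> (\<exists>q\<in>out b f. \<forall>p\<in>out a f. q < p)" for f
  define col :: "(nat \<rightharpoonup> 'm) \<Rightarrow> nat" where "col f = of_bool (early f)" for f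
  let ?act = "\<lambda>_ :: nat. mult M"
  have rp: "ramsey_property M (\<lambda>_. carrier M) ?act (\<lambda>_. \<one>\<^bsub>M\<^esub>)"
    by (rule ramsey_monoid_any_type[OF M \<open>ramsey_monoid M\<close>]) (rule pointed_mset_regular[OF M])
  have "col ` fin_pfuns (\<lambda>_. carrier M) \<subseteq> {0, 1}" by (auto simp: col_def)
  then have "finite (col ` fin_pfuns (\<lambda>_. carrier M))" by (rule finite_subset) simp
  then obtain F c where F: "\<And>i. F i \<in> fin_pfuns (\<lambda>_. carrier M)"
      "\<And>i. pf_prec (F i) (F (Suc i))" "\<And>i. \<exists>p\<in>dom (F i). F i p = Some \<one>\<^bsub>M\<^esub>"
      "\<And>g. g \<in> pf_span M ?act F \<Longrightarrow> col g = c"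
    using rp[unfolded ramsey_property_def, rule_format, of col] by blast
  define g where "g c = pf_act ?act c (F 0) ++ pf_act ?act \<one>\<^bsub>M\<^esub> (F 1)" for c
  have less: "p < q" if "p \<in> dom (F 0)" "q \<in> dom (F 1)" for p q
    using pf_prec_less[of "F 0" "F 1"] F(2)[of 0] F(1) that
    by (simp add: fin_pfuns_def)
  \<comment> \<open>Since \<open>++\<close> prefers its right argument, \<open>F 0\<close> shows
    through here only because the two domains are disjoint.\<close>
  have g_first: "g c p = map_option (mult M c) (F 0 p)" if "p \<in> dom (F 0)" for c p
  proof -
    have "p \<notin> dom (F 1)" using less that by blast
    then show ?thesis
      by (simp add: g_def pf_act_def map_add_def domIff)
  qed
  obtain p where p: "p \<in> dom (F 0)" "F 0 p = Some \<one>\<^bsub>M\<^esub>" using F(3) by blast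
  \<comment> \<open>Acting by \<open>c\<close> pushes all values of \<open>F 0\<close> into the
    right ideal \<open>cM\<close>, so a value of \<open>g c\<close> outside it sits in the domain of
    \<open>F 1\<close>, beyond \<open>p\<close>.\<close>
  have out_self: "p < q" if "q \<in> out c (g c)" for c q
  proof -
    have "q \<notin> dom (F 0)"
    proof
      assume q: "q \<in> dom (F 0)"
      then obtain y where y: "F 0 q = Some y" by blast
      then have "y \<in> carrier M" using F(1)[of 0] q by (force simp: fin_pfuns_def)
      then show False using \<open>q \<in> out c (g c)\<close> g_first[OF q] y by (auto simp: out_def)
    qed
    moreover have "q \<in> dom (F 0) \<union> dom (F 1)"
      using \<open>q \<in> out c (g c)\<close>
      by (auto simp: out_def g_def pf_act_def map_add_def domIff split: option.splits)
    ultimately show ?thesis using less p(1) by blast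
  qed
  \<comment> \<open>The value of \<open>g a\<close> at \<open>p\<close> is \<open>a\<close> times
    the distinguished point \<open>1\<close>, hence \<open>a\<close> itself.\<close>
  have "p \<in> out b (g a)" using g_first[OF p(1)] p(2) a ab by (simp add: out_def)
  then have "early (g a)" unfolding early_def using out_self by blast
  moreover have "p \<in> out a (g b)" using g_first[OF p(1)] p(2) b ba by (simp add: out_def)
  \<comment> \<open>Every position in \<open>out b (g b)\<close> comes after \<open>p\<close>, so
    none precedes all of \<open>out a (g b)\<close>.\<close>
  then have "\<not> early (g b)" unfolding early_def using out_self less_asym by blast
  moreover have "col (g a) = col (g b)"
    unfolding g_def using F(4)[OF pf_span_act_first[OF M a]] F(4)[OF pf_span_act_first[OF M b]]
    by simp
  ultimately show False by (simp add: col_def)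
qed

text \<open>From length two on, both letters occur, so the two sides of a braid relation use the
  same generators.\<close>

lemma set_alternating:
  assumes "2 \<le> k" shows "set (alternating k a b) = {a, b}"
proof -
  have sub: "set (alternating l x y) \<subseteq> {x, y}" for l and x y :: 'a
    by (induction l arbitrary: x y) force+
  obtain l where "k = Suc (Suc l)" using assms by (metis add_2_eq_Suc le_Suc_ex)
  then show ?thesis using sub[of l a b] by auto
qed

text \<open>Equality of letter sets is itself a congruence on words, because \<open>set\<close>
  turns concatenation into union; it therefore contains the congruence generated by
  \<open>R\<close>.\<close>

lemma pres_cong_set_eq:
  assumes "(u, v) \<in> pres_cong S R" and "\<And>u v. (u, v) \<in> R \<Longrightarrow> set u = set v"
  shows "set u = set v"
  using assms by (induction rule: pres_cong.induct) auto

text \<open>A word for an element of the right ideal of \<open>j\<close> must contain the letter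
  \<open>j\<close>, which \<open>[i]\<close> does not.\<close>

lemma presented_monoid_generator_not_in_ideal:
  assumes R: "\<And>u v. (u, v) \<in> R \<Longrightarrow> set u = set v"
    and "i \<in> S" "j \<in> S" "i \<noteq> j"
  shows "pres_cong S R `` {[i]} \<notin>
    mult (presented_monoid S R) (pres_cong S R `` {[j]}) ` carrier (presented_monoid S R)"
proof
  assume "pres_cong S R `` {[i]} \<in>
    mult (presented_monoid S R) (pres_cong S R `` {[j]}) ` carrier (presented_monoid S R)"
  then obtain u where u: "u \<in> lists S"
    "pres_cong S R `` {[i]} = pres_cong S R `` {[j]} \<otimes>\<^bsub>presented_monoid S R\<^esub> pres_cong S R `` {u}"
    unfolding presented_monoid_carrier by blast
  then have "pres_cong S R `` {[i]} = pres_cong S R `` {[j] @ u}"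
    using presented_monoid_mult[of "[j]" S u R] assms by simp
  then have "([i], [j] @ u) \<in> pres_cong S R"
    using eq_equiv_class_iff[OF equiv_pres_cong, of "[i]" S "[j] @ u" R] u assms by simp
  then have "set [i] = set ([j] @ u)" using R by (rule pres_cong_set_eq)
  then show False using \<open>i \<noteq> j\<close> by auto
qed

theorem corollary5p2:
  fixes n :: nat and m :: "nat \<Rightarrow> nat \<Rightarrow> enat"
  assumes "coxeter_matrix n m"
    and "finite (carrier (coxeter_group n m))"
    and "n \<ge> 2"
  shows "\<not> ramsey_monoid (hecke0_monoid n m)"
proof -
  define R where "R = {([i, i], [i]) | i. i \<in> {1..n}} \<union>
       {(alternating k i j, alternating k j i) | i j k.
         i \<in> {1..n} \<and> j \<in> {1..n} \<and> i \<noteq> j \<and> m i j = enat k}"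
  let ?M = "presented_monoid {1..n} R"
  have M: "hecke0_monoid n m = ?M" by (simp add: hecke0_monoid_def R_def)
  have k: "2 \<le> k" if "i \<in> {1..n}" "j \<in> {1..n}" "i \<noteq> j" "m i j = enat k" for i j k
  proof -
    have "2 \<le> m i j" using assms(1) that unfolding coxeter_matrix_def by blast
    then show ?thesis using that(4) by (simp add: numeral_eq_enat)
  qed
  \<comment> \<open>The idempotent relations keep the single letter; the braid relations have length
    at least two by \<open>k\<close>.\<close>
  have R: "set u = set v" if "(u, v) \<in> R" for u v
    using that unfolding R_def by (auto simp: set_alternating[OF k])
  let ?gen = "\<lambda>i. pres_cong {1..n} R `` {[i]}"
  have gen: "?gen i \<in> carrier ?M" if "i \<in> {1..n}" for i
    unfolding presented_monoid_carrier by (rule imageI) (use that in simp)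
  have mem: "1 \<in> {1..n}" "2 \<in> {1..n}" using assms(3) by auto
  have "?gen 1 \<notin> mult ?M (?gen 2) ` carrier ?M" "?gen 2 \<notin> mult ?M (?gen 1) ` carrier ?M"
    by (rule presented_monoid_generator_not_in_ideal[OF R]; use mem in simp)+
  then show ?thesis
    unfolding M
    by (intro not_ramsey_monoid_if_incomparable[OF monoid_presented_monoid gen[OF mem(1)] gen[OF mem(2)]])
qed

end
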